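(* Let $K\in L^\infty_{\mathrm{loc}}([0,+\infty))$, and let $g\not\equiv 0$ be a solution of $g''+Kg=0$. Then $g$ oscillates in each of the following cases. (1) $K$ satisfies $$K(t)\ge -B^2t^\alpha\qquad\text{when } t>t_0,$$ for some $B>0$, $\alpha\ge-2$ and $t_0>0$, and the following condition (according to the value of $\alpha$) holds: $$\text{for }\alpha=-2,\qquad \limsup_{t\to+\infty}\left(\int_{t_0}^t\sqrt{K(\sigma)+\frac{B^2}{\sigma^2}}\,d\sigma-\frac{\sqrt{1+4B^2}}{2}\log t\right)=+\infty;$$ $$\text{for }\alpha>-2,\qquad \limsup_{t\to+\infty}\left(\int_{t_0}^t\sqrt{K(\sigma)+B^2\sigma^\alpha}\,d\sigma-\frac{2B}{\alpha+2}\,t^{\frac{\alpha}{2}+1}\right)=+\infty.$$ (2) $K$ satisfies $$K(t)\ge\frac{B^2}{t^2}\qquad\text{when } t>t_0,$$ for some $B\in[0,1/2]$ and $t_0>0$, and the following condition (according to the value of $B$) holds: $$\text{for }B<\tfrac12,\qquad \limsup_{t\to+\infty}\left(\int_{t_0}^t\sqrt{K(\sigma)-\frac{B^2}{\sigma^2}}\,d\sigma-\frac{\sqrt{1-4B^2}}{2}\log t\right)=+\infty;$$ $$\text{for }B=\tfrac12,\qquad \limsup_{t\to+\infty}\left(\int_{t_0}^t\sqrt{K(\sigma)-\frac{1}{4\sigma^2}}\,d\sigma-\frac12\log\log t\right)=+\infty.$$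
   Context: Since $K$ is only locally bounded, a solution of $g''+Kg=0$ is a $C^1$ function $g$ on $[0,+\infty)$ with $g'$ locally Lipschitz, satisfying the equation almost everywhere; pointwise inequalities on $K$ are understood almost everywhere. "$g$ oscillates" (is oscillatory) means that $g$ has infinitely many zeros on $[0,+\infty)$. *)

theory Defs
  imports "HOL-Analysis.Analysis"
begin

definition Linf_loc_on :: "real set \<Rightarrow> (real \<Rightarrow> real) \<Rightarrow> bool" where
  "Linf_loc_on S K \<longleftrightarrow>
     K \<in> borel_measurable (lebesgue_on S) \<and>
     (\<forall>C. compact C \<and> C \<subseteq> S \<longrightarrow> (\<exists>M. AE t in lebesgue. t \<in> C \<longrightarrow> \<bar>K t\<bar> \<le> M))"

text \<open>The library's \<^const>\<open>local_lipschitz\<close> concerns functions with an additional parameter;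
  this is the notion without parameter.\<close>

definition locally_lipschitz_on :: "real set \<Rightarrow> (real \<Rightarrow> real) \<Rightarrow> bool" where
  "locally_lipschitz_on S f \<longleftrightarrow>
     (\<forall>x\<in>S. \<exists>u>0. \<exists>L. L-lipschitz_on (cball x u \<inter> S) f)"

text \<open>A solution of \<open>g'' + K g = 0\<close> on \<open>[0,\<infinity>)\<close>: the function \<open>g'\<close> is the derivative of \<open>g\<close>
  (one-sided at \<open>0\<close>), and continuity of \<open>g'\<close> follows from the local Lipschitz condition. Values
  of \<open>g\<close> and \<open>K\<close> at negative arguments are irrelevant.\<close>

definition is_solution :: "(real \<Rightarrow> real) \<Rightarrow> (real \<Rightarrow> real) \<Rightarrow> bool" where
  "is_solution K g \<longleftrightarrow>
     (\<exists>g'. (\<forall>t\<ge>0. (g has_real_derivative g' t) (at t within {0..})) \<and>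
           locally_lipschitz_on {0..} g' \<and>
           (AE t in lebesgue. t \<ge> 0 \<longrightarrow>
              (\<exists>g''. (g' has_real_derivative g'') (at t within {0..}) \<and> g'' + K t * g t = 0)))"

definition oscillates :: "(real \<Rightarrow> real) \<Rightarrow> bool" where
  "oscillates g \<longleftrightarrow> infinite {t. t \<ge> 0 \<and> g t = 0}"

end

theory Submission
  imports Defs "HOL-Real_Asymp.Real_Asymp"
begin

text \<open>Suppose that \<open>g > 0\<close> eventually, and write the lower bound as \<open>K \<ge> - f\<close>. For a positive \<open>h\<close> with
  \<open>h'' \<ge> f h\<close>, the quantity \<open>v = h\<^sup>2 (g'/g - h'/h)\<close> satisfies \<open>v' \<le> - v\<^sup>2 / h\<^sup>2 - (K + f) h\<^sup>2\<close>, so that by AM-GM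
  \<open>v' \<le> - 2 \<bar>v\<bar> sqrt (K + f)\<close> and \<open>ln \<bar>v\<bar>\<close> varies at rate at least \<open>2 sqrt (K + f)\<close>. Applied to
  \<open>h\<^sub>1 = exp (S + R)\<close> and \<open>h\<^sub>2 = exp (S - R)\<close> with \<open>R \<rightarrow> \<infinity>\<close>, this yields
  \<open>\<integral> sqrt (K + f) \<le> C + R\<close>; each case of the theorem is a choice of \<open>R\<close> and \<open>S\<close> for which \<open>R\<close> is at
  most the subtracted term. Since \<open>g'\<close> is only Lipschitz, derivatives exist almost everywhere
  and are integrated by the fundamental theorem for Lipschitz functions.\<close>


section \<open>Calculus of Lipschitz functions differentiable off a negligible set\<close>

text \<open>With \<open>P\<close> an antiderivative of the extension \<open>G\<close> of
  \<open>F\<close>, the classical fundamental theorem evaluates the integral of the difference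
  quotient of \<open>G\<close> as the difference of the quotients of \<open>P\<close> at
  \<open>b\<close> and \<open>a\<close>, which tends to \<open>G b - G a\<close>. The quotients of
  \<open>G\<close> are bounded by \<open>L\<close>, so dominated convergence passes to the limit
  \<open>F'\<close>.\<close>

lemma fundamental_theorem_lipschitz:
  fixes F F' :: "real \<Rightarrow> real"
  assumes ab: "a \<le> b" and lip: "L-lipschitz_on {a..b} F" and N: "negligible N"
    and deriv: "\<And>x. a < x \<Longrightarrow> x < b \<Longrightarrow> x \<notin> N \<Longrightarrow> (F has_real_derivative F' x) (at x)"
  shows "(F' has_integral (F b - F a)) {a..b}"
proof -
  \<comment> \<open>Extending \<open>F\<close> by constants keeps the Lipschitz constant
    \<open>L\<close> on the whole line, so \<open>G (x + e k)\<close> makes sense for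
    \<open>x\<close> up to \<open>b\<close>.\<close>
  define G where "G x = F (max a (min b x))" for x
  define e where "e = (\<lambda>k. inverse (real (Suc k)))"
  have e0: "e k > 0" "e k \<le> 1" for k
    unfolding e_def by (auto simp: divide_simps)
  have e_lim: "filterlim e (at 0) sequentially"
    unfolding filterlim_at
  proof
    show "e \<longlonglongrightarrow> 0" unfolding e_def by (rule LIMSEQ_inverse_real_of_nat)
    show "\<forall>\<^sub>F k in sequentially. e k \<in> UNIV \<and> e k \<noteq> 0"
      using e0(1) by (intro always_eventually) (auto simp: less_imp_neq[symmetric])
  qed
  have quot_lim: "(\<lambda>k. (\<phi> (x + e k) - \<phi> x) / e k) \<longlonglongrightarrow> D"
    if "(\<phi> has_real_derivative D) (at x)" for \<phi> x D
    using filterlim_compose[OF that[unfolded DERIV_def] e_lim] .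
  have L0: "L \<ge> 0" using lip by (rule lipschitz_on_nonneg)
  have G_lip: "\<bar>G x - G y\<bar> \<le> L * \<bar>x - y\<bar>" for x y
  proof -
    have "\<bar>G x - G y\<bar> \<le> L * \<bar>max a (min b x) - max a (min b y)\<bar>"
      using lipschitz_onD[OF lip, of "max a (min b x)" "max a (min b y)"] ab
      by (auto simp: G_def dist_real_def)
    also have "\<dots> \<le> L * \<bar>x - y\<bar>"
      by (rule mult_left_mono[OF _ L0]) (auto simp: max_def min_def)
    finally show ?thesis .
  qed
  have "L-lipschitz_on UNIV G"
    using G_lip L0 by (auto simp: lipschitz_on_def dist_real_def)
  then have G_cont: "continuous_on UNIV G"
    by (rule lipschitz_on_continuous_on)
  \<comment> \<open>As \<open>e k <= 1\<close>, shifted points stay below \<open>b + 1\<close>; the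
    larger interval leaves room for two-sided derivatives of \<open>P\<close> there.\<close>
  obtain P where P: "\<And>x. x \<in> {a-1..b+2} \<Longrightarrow> (P has_vector_derivative G x) (at x within {a-1..b+2})"
    using antiderivative_continuous[of "a-1" "b+2" G] continuous_on_subset[OF G_cont] by auto
  have P_deriv: "(P has_real_derivative G x) (at x)" if "a \<le> x" "x \<le> b + 1" for x
    using P[of x] that at_within_interior[of x "{a-1..b+2}"]
    by (simp add: has_real_derivative_iff_has_vector_derivative)
  \<comment> \<open>The endpoints join the exceptional set because \<open>deriv\<close> speaks only
    of interior points; all integrands are set to 0 there.\<close>
  let ?N = "insert a (insert b N)"
  let ?q = "\<lambda>k x. (G (x + e k) - G x) / e k"
  let ?y = "\<lambda>k. (P (b + e k) - P b) / e k - (P (a + e k) - P a) / e k"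
  have "(?q k has_integral ?y k) {a..b}" for k
  proof (rule fundamental_theorem_of_calculus[OF ab])
    fix x assume x: "x \<in> {a..b}"
    have "((\<lambda>x. P (x + e k)) has_real_derivative G (x + e k)) (at x)"
      using DERIV_shift[of P "G (x + e k)" x "e k"] P_deriv[of "x + e k"] x e0[of k] by auto
    then have "((\<lambda>x. (P (x + e k) - P x) / e k) has_real_derivative ?q k x) (at x)"
      using P_deriv[of x] x e0[of k] by (intro DERIV_cdivide DERIV_diff) auto
    then show "((\<lambda>x. (P (x + e k) - P x) / e k) has_vector_derivative ?q k x) (at x within {a..b})"
      by (simp add: has_real_derivative_iff_has_vector_derivative has_vector_derivative_at_within)
  qed
  then have q_int: "((\<lambda>x. if x \<in> ?N then 0 else ?q k x) has_integral ?y k) {a..b}" for k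
    by (rule has_integral_spike[of ?N, rotated 2]) (use N in auto)
  have "((\<lambda>x. if x \<in> ?N then 0 else F' x) has_integral (F b - F a)) {a..b}"
  proof (rule has_integral_dominated_convergence[OF q_int])
    show "(\<lambda>x. L) integrable_on {a..b}" by (rule integrable_const_ivl)
    show "\<forall>x\<in>{a..b}. norm (if x \<in> ?N then 0 else ?q k x) \<le> L" for k
    proof
      fix x
      show "norm (if x \<in> ?N then 0 else ?q k x) \<le> L"
        using G_lip[of "x + e k" x] e0(1)[of k] L0 by (auto simp: divide_simps)
    qed
    show "\<forall>x\<in>{a..b}. (\<lambda>k. if x \<in> ?N then 0 else ?q k x) \<longlonglongrightarrow> (if x \<in> ?N then 0 else F' x)"
    proof
      fix x assume x: "x \<in> {a..b}"
      show "(\<lambda>k. if x \<in> ?N then 0 else ?q k x) \<longlonglongrightarrow> (if x \<in> ?N then 0 else F' x)"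
      proof (cases "x \<in> ?N")
        case False
        then have x': "a < x" "x < b" "x \<notin> N" using x by auto
        have "(G has_real_derivative F' x) (at x)"
          by (rule has_field_derivative_transform_within_open[OF deriv[OF x'], of "{a<..<b}"])
            (use x' in \<open>auto simp: G_def\<close>)
        then show ?thesis using quot_lim False by auto
      qed auto
    qed
    have "?y \<longlonglongrightarrow> G b - G a"
      using ab by (intro tendsto_diff quot_lim P_deriv) auto
    then show "?y \<longlonglongrightarrow> F b - F a" using ab by (simp add: G_def)
  qed
  then show ?thesis
    by (rule has_integral_spike[of ?N, rotated 2]) (use N in auto)
qed

text \<open>Choice turns the existential bound into a function \<open>D\<close>, and the exact
  formula for the increment of \<open>F\<close> is compared pointwise with \<open>G\<close>. This is
  how differential inequalities valid off \<open>N\<close> are integrated below.\<close>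

lemma lipschitz_increment_le_integral:
  fixes F G :: "real \<Rightarrow> real"
  assumes "a \<le> b" and "L-lipschitz_on {a..b} F" and N: "negligible N"
    and deriv: "\<And>x. a < x \<Longrightarrow> x < b \<Longrightarrow> x \<notin> N \<Longrightarrow> \<exists>D. (F has_real_derivative D) (at x) \<and> D \<le> G x"
    and G: "G integrable_on {a..b}"
  shows "F b - F a \<le> integral {a..b} G"
proof -
  obtain D where D: "\<And>x. a < x \<Longrightarrow> x < b \<Longrightarrow> x \<notin> N \<Longrightarrow> (F has_real_derivative D x) (at x) \<and> D x \<le> G x"
    using deriv by metis
  \<comment> \<open>The default \<open>G x\<close> on the exceptional set makes
    \<open>D' x <= G x\<close> hold on all of \<open>{a..b}\<close>.\<close>
  define D' where "D' x = (if x \<in> insert a (insert b N) then G x else D x)" for x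
  have "(D' has_integral (F b - F a)) {a..b}"
    by (rule fundamental_theorem_lipschitz[of a b L F "insert a (insert b N)"]) (use assms D in \<open>auto simp: D'_def\<close>)
  then show ?thesis
    using integrable_integral[OF G] by (rule has_integral_le) (use D in \<open>auto simp: D'_def\<close>)
qed

lemma lipschitz_on_mult_interval:
  fixes f h :: "real \<Rightarrow> real"
  assumes f: "L-lipschitz_on {a..b} f" and h: "M-lipschitz_on {a..b} h"
  shows "\<exists>C. C-lipschitz_on {a..b} (\<lambda>x. f x * h x)"
proof -
  have "bounded (f ` {a..b})" "bounded (h ` {a..b})"
    using assms[THEN lipschitz_on_continuous_on]
    by (auto intro!: compact_imp_bounded compact_continuous_image)
  then obtain A B where A: "\<And>x. x \<in> {a..b} \<Longrightarrow> \<bar>f x\<bar> \<le> A" "A > 0"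
    and B: "\<And>x. x \<in> {a..b} \<Longrightarrow> \<bar>h x\<bar> \<le> B" "B > 0"
    unfolding bounded_pos by (metis imageI real_norm_def)
  have nn: "L \<ge> 0" "M \<ge> 0" using assms lipschitz_on_nonneg by auto
  have "(A * M + B * L)-lipschitz_on {a..b} (\<lambda>x. f x * h x)"
  proof (rule lipschitz_onI)
    fix x y assume xy: "x \<in> {a..b}" "y \<in> {a..b}"
    have "f x * h x - f y * h y = f x * (h x - h y) + h y * (f x - f y)" by algebra
    then have "\<bar>f x * h x - f y * h y\<bar> \<le> \<bar>f x\<bar> * \<bar>h x - h y\<bar> + \<bar>h y\<bar> * \<bar>f x - f y\<bar>"
      by (metis abs_mult abs_triangle_ineq)
    also have "\<dots> \<le> A * (M * \<bar>x - y\<bar>) + B * (L * \<bar>x - y\<bar>)"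
      using lipschitz_onD[OF f xy] lipschitz_onD[OF h xy] A B xy nn
      by (intro add_mono mult_mono) (auto simp: dist_real_def less_imp_le)
    finally show "dist (f x * h x) (f y * h y) \<le> (A * M + B * L) * dist x y"
      by (simp add: dist_real_def algebra_simps)
  qed (use nn A B in simp)
  then show ?thesis ..
qed

lemma C1_imp_lipschitz_interval:
  fixes f f' :: "real \<Rightarrow> real"
  assumes "\<And>x. x \<in> {a..b} \<Longrightarrow> (f has_real_derivative f' x) (at x)" and "continuous_on {a..b} f'"
  shows "\<exists>C. C-lipschitz_on {a..b} f"
proof -
  have "bounded (f' ` {a..b})"
    using assms by (auto intro!: compact_imp_bounded compact_continuous_image)
  then obtain A where A: "\<And>x. x \<in> {a..b} \<Longrightarrow> \<bar>f' x\<bar> \<le> A" "A > 0"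
    unfolding bounded_pos by (metis imageI real_norm_def)
  have "A-lipschitz_on {a..b} f"
  proof (rule bounded_derivative_imp_lipschitz)
    show "(f has_derivative (\<lambda>h. h * f' x)) (at x within {a..b})" if "x \<in> {a..b}" for x
      using assms(1)[OF that] by (metis has_derivative_at_withinI has_field_derivative_def mult_commute_abs)
    show "onorm (\<lambda>h. h * f' x) \<le> A" if "x \<in> {a..b}" for x
      by (rule onorm_bound) (use A that in \<open>auto simp: abs_mult mult.commute[of _ "f' x"] intro!: mult_right_mono\<close>)
  qed (use A in auto)
  then show ?thesis ..
qed

text \<open>By compactness \<open>f\<close> has a positive minimum \<open>f x0\<close>, and
  \<open>ln u - ln v <= (u - v) / v\<close> then gives the constant \<open>L / f x0\<close>.\<close>

lemma lipschitz_on_ln_interval: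
  fixes f :: "real \<Rightarrow> real"
  assumes f: "L-lipschitz_on {a..b} f" and pos: "\<And>x. x \<in> {a..b} \<Longrightarrow> f x > 0"
  shows "\<exists>C. C-lipschitz_on {a..b} (\<lambda>x. ln (f x))"
proof (cases "a \<le> b")
  case True
  have cont: "continuous_on {a..b} f" using f by (rule lipschitz_on_continuous_on)
  obtain x0 where x0: "x0 \<in> {a..b}" "\<And>x. x \<in> {a..b} \<Longrightarrow> f x0 \<le> f x"
    using continuous_attains_inf[OF compact_Icc _ cont] True by auto
  have "f x0 > 0" using pos x0 by auto
  have L0: "L \<ge> 0" using f by (rule lipschitz_on_nonneg)
  have ln_diff: "ln (f x) - ln (f y) \<le> L / f x0 * \<bar>x - y\<bar>" if xy: "x \<in> {a..b}" "y \<in> {a..b}" for x y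
  proof -
    have "ln (f x) - ln (f y) \<le> (f x - f y) / f y"
      using pos xy by (intro ln_diff_le) auto
    also have "\<dots> \<le> (L * \<bar>x - y\<bar>) / f x0"
      using lipschitz_onD[OF f xy] x0(2)[OF xy(2)] \<open>f x0 > 0\<close> L0
      by (intro frac_le) (auto simp: dist_real_def)
    finally show ?thesis by simp
  qed
  have "(L / f x0)-lipschitz_on {a..b} (\<lambda>x. ln (f x))"
  proof (rule lipschitz_onI)
    fix x y assume "x \<in> {a..b}" "y \<in> {a..b}"
    then show "dist (ln (f x)) (ln (f y)) \<le> L / f x0 * dist x y"
      using ln_diff[of x y] ln_diff[of y x] by (auto simp: dist_real_def abs_le_iff abs_minus_commute)
  qed (use L0 \<open>f x0 > 0\<close> in auto)
  then show ?thesis ..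
qed (auto intro: exI[of _ 0])


section \<open>Wronskian comparison with a positive function\<close>

text \<open>\<open>N\<close> collects the exceptional points of both the equation and the bound
  \<open>K >= - f\<close>, so later arguments are pointwise off a single negligible set.\<close>

locale positive_solution =
  fixes K f g g' :: "real \<Rightarrow> real" and N :: "real set" and T :: real
  assumes g_pos: "t \<ge> T \<Longrightarrow> g t > 0"
    and g_deriv: "t \<ge> T \<Longrightarrow> (g has_real_derivative g' t) (at t)"
    and g'_lipschitz: "T \<le> a \<Longrightarrow> \<exists>L. L-lipschitz_on {a..b} g'"
    and N_negligible: "negligible N"
    and g'_deriv: "t \<ge> T \<Longrightarrow> t \<notin> N \<Longrightarrow> (g' has_real_derivative - (K t * g t)) (at t)"
    and lower_bound: "t \<ge> T \<Longrightarrow> t \<notin> N \<Longrightarrow> K t + f t \<ge> 0"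
    and sqrt_integrable: "T \<le> a \<Longrightarrow> (\<lambda>t. sqrt (K t + f t)) integrable_on {a..b}"

locale comparison = positive_solution +
  fixes h h' h'' :: "real \<Rightarrow> real"
  assumes h_pos: "t \<ge> T \<Longrightarrow> h t > 0"
    and h_deriv: "t \<ge> T \<Longrightarrow> (h has_real_derivative h' t) (at t)"
    and h'_deriv: "t \<ge> T \<Longrightarrow> (h' has_real_derivative h'' t) (at t)"
    and h'_lipschitz: "T \<le> a \<Longrightarrow> \<exists>L. L-lipschitz_on {a..b} h'"
    and h''_ge: "t \<ge> T \<Longrightarrow> f t * h t \<le> h'' t"
begin

text \<open>The Wronskian of \<open>h\<close> and \<open>g\<close>; it has the sign of the
  derivative of \<open>g / h\<close>.\<close>

definition W :: "real \<Rightarrow> real" where "W t = g' t * h t - g t * h' t"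

definition z :: "real \<Rightarrow> real" where "z t = g t / h t"

lemma z_pos: "t \<ge> T \<Longrightarrow> z t > 0"
  by (simp add: z_def g_pos h_pos)

lemma z_deriv: "t \<ge> T \<Longrightarrow> (z has_real_derivative W t / (h t)\<^sup>2) (at t)"
  unfolding z_def[abs_def] W_def
  using DERIV_divide[OF g_deriv h_deriv, of t] h_pos[of t] by (simp add: power2_eq_square)

text \<open>The products \<open>g' * h'\<close> cancel in the derivative of the Wronskian; the
  equation for \<open>g\<close> and \<open>h''_ge\<close> bound what remains.\<close>

lemma W_deriv:
  assumes "t \<ge> T" "t \<notin> N"
  shows "\<exists>D. (W has_real_derivative D) (at t) \<and> D \<le> - ((K t + f t) * g t * h t)"
proof (intro exI conjI)
  show "(W has_real_derivative - (K t * g t) * h t - g t * h'' t) (at t)"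
    unfolding W_def[abs_def]
    by (auto intro!: derivative_eq_intros g_deriv h_deriv g'_deriv h'_deriv assms simp: algebra_simps)
  have "g t * (f t * h t) \<le> g t * h'' t"
    using h''_ge[of t] g_pos[of t] assms by (intro mult_left_mono) auto
  then show "- (K t * g t) * h t - g t * h'' t \<le> - ((K t + f t) * g t * h t)"
    by (simp add: algebra_simps)
qed

lemma g_h_lipschitz:
  assumes "T \<le> a"
  shows "\<exists>L. L-lipschitz_on {a..b} g" "\<exists>L. L-lipschitz_on {a..b} h"
  using C1_imp_lipschitz_interval[of a b g g'] C1_imp_lipschitz_interval[of a b h h']
    g'_lipschitz[OF assms] h'_lipschitz[OF assms] g_deriv h_deriv lipschitz_on_continuous_on assms
  by (meson atLeastAtMost_iff order_trans)+

lemma W_lipschitz: "T \<le> a \<Longrightarrow> \<exists>L. L-lipschitz_on {a..b} W"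
  unfolding W_def[abs_def]
  using lipschitz_on_mult_interval[of _ a b g' _ h] lipschitz_on_mult_interval[of _ a b g _ h']
    g'_lipschitz[of a b] h'_lipschitz[of a b] g_h_lipschitz[of a b] lipschitz_on_diff
  by blast

text \<open>Off \<open>N\<close> the bound of \<open>W_deriv\<close> is nonpositive, as
  \<open>K + f\<close> is nonnegative and \<open>g\<close>, \<open>h\<close> are positive; Lipschitz
  continuity rules out any increase across \<open>N\<close>.\<close>

lemma W_antimono:
  assumes "T \<le> a" "a \<le> b"
  shows "W b \<le> W a"
proof -
  obtain L where "L-lipschitz_on {a..b} W" using W_lipschitz assms by blast
  then have "W b - W a \<le> integral {a..b} (\<lambda>_. 0)"
  proof (rule lipschitz_increment_le_integral[OF assms(2) _ N_negligible])
    fix t assume t: "a < t" "t < b" "t \<notin> N"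
    then have "0 \<le> (K t + f t) * g t * h t"
      using g_pos[of t] h_pos[of t] lower_bound[of t] assms by simp
    then show "\<exists>D. (W has_real_derivative D) (at t) \<and> D \<le> 0"
      using W_deriv[of t] t assms by fastforce
  qed (rule integrable_0)
  then show ?thesis by simp
qed

lemma ln_z_lipschitz:
  assumes "T \<le> a"
  shows "\<exists>L. L-lipschitz_on {a..b} (\<lambda>t. ln (z t))"
proof -
  obtain L M where "L-lipschitz_on {a..b} (\<lambda>t. ln (g t))" "M-lipschitz_on {a..b} (\<lambda>t. ln (h t))"
    using g_h_lipschitz[OF assms, of b] lipschitz_on_ln_interval[of _ a b g]
      lipschitz_on_ln_interval[of _ a b h] g_pos h_pos assms
    by (metis atLeastAtMost_iff order_trans)
  then have "(L + M)-lipschitz_on {a..b} (\<lambda>t. ln (g t) - ln (h t))"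
    by (rule lipschitz_on_diff)
  then have "(L + M)-lipschitz_on {a..b} (\<lambda>t. ln (z t))"
    by (rule lipschitz_on_transform)
      (use assms in \<open>auto simp: z_def intro!: ln_divide_pos g_pos h_pos\<close>)
  then show ?thesis ..
qed

text \<open>Here \<open>W / z = h\<^sup>2 (g'/g - h'/h)\<close>, the monotone quantity \<open>v\<close>.\<close>

lemma log_decrease:
  assumes T: "T \<le> a" and ab: "a \<le> b" and \<sigma>: "\<sigma> = 1 \<or> \<sigma> = -1"
    and pos: "\<And>t. a \<le> t \<Longrightarrow> t \<le> b \<Longrightarrow> \<sigma> * W t > 0"
  defines "E \<equiv> \<lambda>t. ln (\<sigma> * W t / z t)"
  shows "2 * integral {a..b} (\<lambda>t. sqrt (K t + f t)) \<le> \<sigma> * (E a - E b)"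
proof -
  \<comment> \<open>\<open>\<sigma>\<close> is the sign of \<open>W\<close>, so \<open>F\<close> is
    \<open>\<sigma> * ln \<bar>W / z\<bar>\<close>. The outer factor makes \<open>F\<close> decrease
    in both cases: the logarithm falls where \<open>W > 0\<close> and grows where
    \<open>W < 0\<close>.\<close>
  define F where "F t = \<sigma> * (ln (\<sigma> * W t) - ln (z t))" for t
  have E: "\<sigma> * E t = F t" if "a \<le> t" "t \<le> b" for t
    using pos[OF that] z_pos[of t] that T by (simp add: E_def F_def ln_divide_pos)
  obtain L where "L-lipschitz_on {a..b} F"
  proof -
    obtain L where "L-lipschitz_on {a..b} W" using W_lipschitz T by blast
    then have "(\<bar>\<sigma>\<bar> * L)-lipschitz_on {a..b} (\<lambda>t. \<sigma> * W t)" by (rule lipschitz_on_cmult_real)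
    then have "\<exists>M. M-lipschitz_on {a..b} (\<lambda>t. ln (\<sigma> * W t))"
      by (rule lipschitz_on_ln_interval) (use pos in auto)
    then obtain M where "M-lipschitz_on {a..b} (\<lambda>t. ln (\<sigma> * W t))" ..
    moreover obtain M' where "M'-lipschitz_on {a..b} (\<lambda>t. ln (z t))" using ln_z_lipschitz T by blast
    ultimately have "(\<bar>\<sigma>\<bar> * (M + M'))-lipschitz_on {a..b} (\<lambda>t. \<sigma> * (ln (\<sigma> * W t) - ln (z t)))"
      by (intro lipschitz_on_cmult_real lipschitz_on_diff)
    then show ?thesis using that unfolding F_def[abs_def] by blast
  qed
  then have "F b - F a \<le> integral {a..b} (\<lambda>t. - 2 * sqrt (K t + f t))"
  proof (rule lipschitz_increment_le_integral[OF ab _ N_negligible])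
    show "(\<lambda>t. - 2 * sqrt (K t + f t)) integrable_on {a..b}"
      using integrable_cmul[OF sqrt_integrable[OF T], of "-2"] by simp
    fix t assume t: "a < t" "t < b" "t \<notin> N"
    then have tT: "t \<ge> T" using T by simp
    obtain D where D: "(W has_real_derivative D) (at t)" "D \<le> - ((K t + f t) * g t * h t)"
      using W_deriv tT t by blast
    have p: "\<sigma> * W t > 0" "g t > 0" "h t > 0" "z t > 0" "K t + f t \<ge> 0"
      using pos t g_pos h_pos z_pos lower_bound tT by auto
    let ?D = "\<sigma> * (\<sigma> * D / (\<sigma> * W t) - W t / (h t)\<^sup>2 / z t)"
    have "(F has_real_derivative ?D) (at t)"
      unfolding F_def[abs_def] using p \<sigma>
      by (auto intro!: derivative_eq_intros D(1) z_deriv tT)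
    moreover have "?D \<le> - 2 * sqrt (K t + f t)"
    proof -
      define A where "A = \<sigma> * W t"
      define q where "q = sqrt (K t + f t)"
      have q: "q\<^sup>2 = K t + f t" using p by (simp add: q_def)
      \<comment> \<open>Since \<open>\<sigma> * \<sigma> = 1\<close> and
        \<open>z * h^2 = g * h\<close>, both signs lead to the same expression in
        \<open>A = \<bar>W\<bar>\<close>.\<close>
      have D_eq: "?D = D / A - A / (g t * h t)"
        using \<sigma> p by (auto simp: A_def z_def power2_eq_square field_simps)
      have "D / A \<le> - (q\<^sup>2 * g t * h t) / A"
        using D(2) p unfolding q A_def by (intro divide_right_mono) auto
      then have "?D \<le> - (q\<^sup>2 * (g t * h t) / A + A / (g t * h t))"
        unfolding D_eq by (simp add: mult.assoc)
      also have "\<dots> \<le> - 2 * q"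
      proof -
        \<comment> \<open>AM-GM for \<open>q^2 * u / A\<close> and \<open>A / u\<close>, whose
          product is \<open>q^2\<close>, with the defect written as a square.\<close>
        define u where "u = g t * h t"
        have "u > 0" "A > 0" using p by (auto simp: u_def A_def)
        then have "q\<^sup>2 * u / A + A / u - 2 * q = (q * u - A)\<^sup>2 / (A * u)"
          by (simp add: field_simps power2_eq_square)
        also have "\<dots> \<ge> 0" using \<open>u > 0\<close> \<open>A > 0\<close> by simp
        finally show ?thesis by (simp add: u_def)
      qed
      finally show ?thesis by (simp add: q_def)
    qed
    ultimately show "\<exists>D. (F has_real_derivative D) (at t) \<and> D \<le> - 2 * sqrt (K t + f t)" by blast
  qed
  then have "2 * integral {a..b} (\<lambda>t. sqrt (K t + f t)) \<le> F a - F b" by simp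
  then show ?thesis using E[of a] E[of b] ab by (simp add: right_diff_distrib)
qed

end


section \<open>Integral bound from two exponential comparison functions\<close>

context positive_solution
begin

text \<open>For \<open>h = exp P\<close> the quotient \<open>h'' / h\<close> is
  \<open>p' + p^2\<close>, so the condition \<open>h'' >= f * h\<close> becomes a Riccati inequality
  for \<open>p\<close>.\<close>

lemma comparison_exp:
  assumes P: "\<And>t. t \<ge> T \<Longrightarrow> (P has_real_derivative p t) (at t)"
    and p: "\<And>t. t \<ge> T \<Longrightarrow> (p has_real_derivative p' t) (at t)"
    and p'_cont: "continuous_on {T..} p'"
    and riccati: "\<And>t. t \<ge> T \<Longrightarrow> f t \<le> p' t + (p t)\<^sup>2"
  shows "comparison K f g g' N T (\<lambda>t. exp (P t)) (\<lambda>t. p t * exp (P t))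
    (\<lambda>t. (p' t + (p t)\<^sup>2) * exp (P t))"
proof
  show h: "((\<lambda>t. exp (P t)) has_real_derivative p t * exp (P t)) (at t)" if "t \<ge> T" for t
    using DERIV_fun_exp[OF P[OF that]] by (simp add: mult.commute)
  show h': "((\<lambda>t. p t * exp (P t)) has_real_derivative (p' t + (p t)\<^sup>2) * exp (P t)) (at t)"
    if "t \<ge> T" for t
    using DERIV_mult[OF p[OF that] h[OF that]] by (simp add: algebra_simps power2_eq_square)
  show "\<exists>L. L-lipschitz_on {a..b} (\<lambda>t. p t * exp (P t))" if "T \<le> a" for a b
  proof (rule C1_imp_lipschitz_interval[OF h'])
    have "continuous_on {a..b} P" "continuous_on {a..b} p"
      using that
      by (auto intro!: DERIV_continuous_on[of _ P p] DERIV_continuous_on[of _ p p']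
        has_field_derivative_at_within[OF P] has_field_derivative_at_within[OF p])
    moreover have "continuous_on {a..b} p'"
      using p'_cont by (rule continuous_on_subset) (use that in auto)
    ultimately show "continuous_on {a..b} (\<lambda>t. (p' t + (p t)\<^sup>2) * exp (P t))"
      by (intro continuous_intros)
  qed (use that in auto)
  show "f t * exp (P t) \<le> (p' t + (p t)\<^sup>2) * exp (P t)" if "t \<ge> T" for t
    using riccati[OF that] by simp
qed simp

text \<open>A solution cannot have \<open>g'/g < h\<^sub>2'/h\<^sub>2\<close>, since \<open>g/h\<^sub>2\<close> would reach \<open>0\<close>. If always
  \<open>g'/g \<ge> h\<^sub>1'/h\<^sub>1\<close>, the decrease of \<open>ln \<bar>v\<bar>\<close> is used for \<open>h\<^sub>2\<close>, otherwise for \<open>h\<^sub>1\<close>; the gap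
  \<open>h\<^sub>1'/h\<^sub>1 - h\<^sub>2'/h\<^sub>2 = 2 r\<close> bounds \<open>\<bar>v\<bar>\<close> from below and above, respectively.\<close>

lemma integral_sqrt_bound:
  fixes R S r s r' s' :: "real \<Rightarrow> real"
  assumes R: "\<And>t. t \<ge> T \<Longrightarrow> (R has_real_derivative r t) (at t)"
    and S: "\<And>t. t \<ge> T \<Longrightarrow> (S has_real_derivative s t) (at t)"
    and r: "\<And>t. t \<ge> T \<Longrightarrow> (r has_real_derivative r' t) (at t)"
    and s: "\<And>t. t \<ge> T \<Longrightarrow> (s has_real_derivative s' t) (at t)"
    and cont: "continuous_on {T..} r'" "continuous_on {T..} s'"
    and riccati: "\<And>t. t \<ge> T \<Longrightarrow> f t \<le> s' t + r' t + (s t + r t)\<^sup>2"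
      "\<And>t. t \<ge> T \<Longrightarrow> f t \<le> s' t - r' t + (s t - r t)\<^sup>2"
    and m: "m > 0" "\<And>t. t \<ge> T \<Longrightarrow> m \<le> exp (2 * S t) * r t"
    and M: "\<And>t. t \<ge> T \<Longrightarrow> exp (2 * S t) * r t \<le> M"
    and R_lim: "filterlim R at_top at_top"
  shows "\<exists>C a. T \<le> a \<and> (\<forall>t\<ge>a. integral {a..t} (\<lambda>t. sqrt (K t + f t)) \<le> C + R t)"
proof -
  \<comment> \<open>The Wronskian \<open>h1' * h2 - h1 * h2'\<close> equals
    \<open>2 * exp (2 * S) * r\<close>; the hypotheses on \<open>m\<close> and \<open>M\<close> keep
    it between positive constants.\<close>
  let ?h1 = "\<lambda>t. exp (S t + R t)" and ?h2 = "\<lambda>t. exp (S t - R t)"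
  interpret h1: comparison K f g g' N T ?h1 "\<lambda>t. (s t + r t) * ?h1 t"
    "\<lambda>t. (s' t + r' t + (s t + r t)\<^sup>2) * ?h1 t"
    by (rule comparison_exp)
      (intro DERIV_add R S r s continuous_on_add cont riccati; assumption)+
  interpret h2: comparison K f g g' N T ?h2 "\<lambda>t. (s t - r t) * ?h2 t"
    "\<lambda>t. (s' t - r' t + (s t - r t)\<^sup>2) * ?h2 t"
    by (rule comparison_exp)
      (intro DERIV_diff R S r s continuous_on_diff cont riccati; assumption)+
  have W1: "h1.W t = g t * ?h1 t * (g' t / g t - (s t + r t))"
    and W2: "h2.W t = g t * ?h2 t * (g' t / g t - (s t - r t))" if "t \<ge> T" for t
    using g_pos[OF that] unfolding h1.W_def h2.W_def by (simp_all add: field_simps)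
  have v1: "h1.W t / h1.z t = exp (2 * S t) * exp (2 * R t) * (g' t / g t - (s t + r t))"
    and v2: "h2.W t / h2.z t = exp (2 * S t) * exp (- (2 * R t)) * (g' t / g t - (s t - r t))"
    if "t \<ge> T" for t
  proof -
    have "(?h1 t)\<^sup>2 = exp (2 * S t) * exp (2 * R t)" "(?h2 t)\<^sup>2 = exp (2 * S t) * exp (- (2 * R t))"
      by (simp_all add: power2_eq_square exp_add[symmetric])
    moreover have "h1.W t / h1.z t = (?h1 t)\<^sup>2 * (g' t / g t - (s t + r t))"
      "h2.W t / h2.z t = (?h2 t)\<^sup>2 * (g' t / g t - (s t - r t))"
      using g_pos[OF that] unfolding W1[OF that] W2[OF that] h1.z_def h2.z_def
      by (simp_all add: power2_eq_square)
    ultimately show "h1.W t / h1.z t = exp (2 * S t) * exp (2 * R t) * (g' t / g t - (s t + r t))"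
      "h2.W t / h2.z t = exp (2 * S t) * exp (- (2 * R t)) * (g' t / g t - (s t - r t))"
      by simp_all
  qed
  have M0: "M > 0" using m(1) m(2)[of T] M[of T] by simp
  have r_pos: "r t > 0" if "t \<ge> T" for t
    using m(1) m(2)[OF that] by (metis exp_gt_zero less_le_trans zero_less_mult_pos)
  have W2_nonneg: "h2.W a \<ge> 0" if a: "a \<ge> T" for a
  proof (rule ccontr)
    assume "\<not> h2.W a \<ge> 0"
    define d where "d = - h2.W a"
    have d: "d > 0" using \<open>\<not> h2.W a \<ge> 0\<close> by (simp add: d_def)
    \<comment> \<open>From \<open>a\<close> on, \<open>h2.W <= - d\<close>, so the derivative of
      \<open>h2.z\<close> is at most \<open>- d * exp (2 * R) / exp (2 * S)\<close>. The bound
      \<open>exp (2 * S) * r <= M\<close> turns this into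
      \<open>- (d / M) * r * exp (2 * R)\<close>, the derivative of
      \<open>- d / (2 * M) * exp (2 * R)\<close>. Hence \<open>Y\<close> cannot increase, although
      \<open>h2.z > 0\<close> and \<open>R\<close> tends to infinity.\<close>
    define Y where "Y t = h2.z t + d / (2 * M) * exp (2 * R t)" for t
    have Y_mono: "Y t \<le> Y a" if "t \<ge> a" for t
    proof (rule DERIV_nonpos_imp_nonincreasing[OF that])
      fix x assume x: "a \<le> x" "x \<le> t"
      then have xT: "x \<ge> T" using a by simp
      let ?D = "h2.W x / (?h2 x)\<^sup>2 + d / (2 * M) * (exp (2 * R x) * (2 * r x))"
      have "(Y has_real_derivative ?D) (at x)"
        unfolding Y_def[abs_def]
        by (rule derivative_eq_intros h2.z_deriv R xT refl | simp)+
      moreover have "?D \<le> 0"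
      proof -
        have e: "(?h2 x)\<^sup>2 = exp (2 * S x) / exp (2 * R x)"
          by (simp add: power2_eq_square exp_add[symmetric] exp_diff[symmetric])
        have "h2.W x \<le> - d" using h2.W_antimono[OF a x(1)] by (simp add: d_def)
        then have "h2.W x / (?h2 x)\<^sup>2 \<le> - d / (?h2 x)\<^sup>2"
          by (rule divide_right_mono) simp
        also have "\<dots> = - d * exp (2 * R x) / exp (2 * S x)" unfolding e by simp
        also have "\<dots> \<le> - (d / M * exp (2 * R x) * r x)"
        proof -
          have "d * exp (2 * R x) * (exp (2 * S x) * r x) \<le> d * exp (2 * R x) * M"
            using M[OF xT] d by (intro mult_left_mono) auto
          then show ?thesis using M0 by (simp add: field_simps)
        qed
        finally show ?thesis by (simp add: field_simps)
      qed
      ultimately show "\<exists>D. (Y has_real_derivative D) (at x) \<and> D \<le> 0" by blast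
    qed
    have "filterlim (\<lambda>t. 2 * R t) at_top at_top"
      by (rule filterlim_tendsto_pos_mult_at_top[OF tendsto_const _ R_lim]) simp
    then have "filterlim (\<lambda>t. exp (2 * R t)) at_top at_top"
      by (rule filterlim_compose[OF exp_at_top])
    then have "eventually (\<lambda>t. exp (2 * R t) > Y a * (2 * M) / d \<and> t \<ge> a) at_top"
      using eventually_ge_at_top[of a] by (auto simp: filterlim_at_top_dense eventually_conj_iff)
    then obtain t where t: "exp (2 * R t) > Y a * (2 * M) / d" "t \<ge> a"
      by (auto simp: eventually_at_top_linorder)
    have "Y a < d / (2 * M) * exp (2 * R t)" using t(1) d M0 by (simp add: field_simps)
    also have "\<dots> < Y t" using h2.z_pos[of t] t a by (simp add: Y_def)
    finally show False using Y_mono[OF t(2)] by simp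
  qed
  show ?thesis
  proof (cases "\<forall>t\<ge>T. h1.W t \<ge> 0")
    case True
    have ge: "g' t / g t - (s t - r t) \<ge> 2 * r t" if "t \<ge> T" for t
    proof -
      have "0 \<le> g' t / g t - (s t + r t)"
        using True[rule_format, OF that] W1[OF that] g_pos[OF that]
          mult_le_cancel_left_pos[of "g t * ?h1 t" 0 "g' t / g t - (s t + r t)"] by simp
      then show ?thesis by simp
    qed
    have W2_pos: "h2.W t > 0" if "t \<ge> T" for t
      using ge[OF that] r_pos[OF that] g_pos[OF that] by (simp add: W2[OF that])
    let ?E = "\<lambda>t. ln (1 * h2.W t / h2.z t)"
    \<comment> \<open>By \<open>v2\<close> and the gap, \<open>?E t >= ln (2 * m) - 2 * R t\<close>,
      while \<open>?E\<close> loses at least twice the integral from \<open>T\<close> to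
      \<open>t\<close>.\<close>
    have "integral {T..t} (\<lambda>t. sqrt (K t + f t)) \<le> (?E T - ln (2 * m)) / 2 + R t" if t: "t \<ge> T" for t
    proof -
      have "2 * m * exp (- (2 * R t)) \<le> exp (2 * S t) * r t * 2 * exp (- (2 * R t))"
        using m(2)[OF t] by (intro mult_right_mono) auto
      also have "\<dots> = exp (2 * S t) * exp (- (2 * R t)) * (2 * r t)" by simp
      also have "\<dots> \<le> 1 * h2.W t / h2.z t"
        unfolding mult_1 v2[OF t] using ge[OF t] by (intro mult_left_mono) auto
      finally have "ln (2 * m * exp (- (2 * R t))) \<le> ?E t"
        using m(1) W2_pos[OF t] h2.z_pos[OF t] by (subst ln_le_cancel_iff) auto
      moreover have "ln (2 * m * exp (- (2 * R t))) = ln (2 * m) - 2 * R t"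
        using m(1) by (subst ln_mult_pos) auto
      ultimately show ?thesis
        using h2.log_decrease[of T t 1] W2_pos t by (simp add: field_simps)
    qed
    then show ?thesis by blast
  next
    case False
    \<comment> \<open>Monotonicity keeps \<open>h1.W\<close> negative from \<open>a\<close> on, so
      the integral starts at \<open>a\<close>, a point depending on the solution.\<close>
    then obtain a where a: "a \<ge> T" "h1.W a < 0" by force
    have W1_neg: "h1.W t < 0" if "t \<ge> a" for t
      using h1.W_antimono[OF a(1) that] a(2) by simp
    let ?E = "\<lambda>t. ln (- 1 * h1.W t / h1.z t)"
    \<comment> \<open>\<open>W2_nonneg\<close> gives \<open>?E t <= ln (2 * M) + 2 * R t\<close>,
      while \<open>?E\<close> gains at least twice the integral from \<open>a\<close> to
      \<open>t\<close>.\<close>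
    have "integral {a..t} (\<lambda>t. sqrt (K t + f t)) \<le> (ln (2 * M) - ?E a) / 2 + R t" if t: "t \<ge> a" for t
    proof -
      have tT: "t \<ge> T" using t a by simp
      have "0 \<le> g' t / g t - (s t - r t)"
        using W2_nonneg[OF tT] W2[OF tT] g_pos[OF tT]
          mult_le_cancel_left_pos[of "g t * ?h2 t" 0 "g' t / g t - (s t - r t)"] by simp
      then have le: "- (g' t / g t - (s t + r t)) \<le> 2 * r t" by simp
      have "- 1 * h1.W t / h1.z t = exp (2 * S t) * exp (2 * R t) * - (g' t / g t - (s t + r t))"
        using v1[OF tT] by (simp add: algebra_simps)
      also have "\<dots> \<le> exp (2 * S t) * exp (2 * R t) * (2 * r t)"
        using le by (intro mult_left_mono) auto
      also have "\<dots> = exp (2 * S t) * r t * (2 * exp (2 * R t))" by simp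
      also have "\<dots> \<le> M * (2 * exp (2 * R t))"
        using M[OF tT] by (intro mult_right_mono) auto
      finally have "?E t \<le> ln (2 * M * exp (2 * R t))"
        using W1_neg[OF t] h1.z_pos[OF tT] M0
        by (subst ln_le_cancel_iff) (auto simp: divide_neg_pos)
      moreover have "ln (2 * M * exp (2 * R t)) = ln (2 * M) + 2 * R t"
        using M0 by (subst ln_mult_pos) auto
      ultimately show ?thesis
        using h1.log_decrease[of a t "- 1"] W1_neg t a by (simp add: field_simps)
    qed
    then show ?thesis using a by blast
  qed
qed

end


section \<open>From a non-oscillating solution to a positive one, and the general criterion\<close>

text \<open>The integrand is measurable and essentially bounded on a set of finite measure.\<close>

lemma sqrt_potential_integrable:
  assumes K: "Linf_loc_on {0..} K" and f: "continuous_on {a..b} f" and a: "a \<ge> 0"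
  shows "set_integrable lebesgue {a..b} (\<lambda>t. sqrt (K t + f t))"
proof -
  obtain B where B: "AE t in lebesgue. t \<in> {a..b} \<longrightarrow> \<bar>K t\<bar> \<le> B"
    using K a unfolding Linf_loc_on_def by (metis atLeastAtMost_iff atLeast_iff compact_Icc order_trans subsetI)
  have "bounded (f ` {a..b})"
    using f by (auto intro!: compact_imp_bounded compact_continuous_image)
  then obtain A where A: "\<And>t. t \<in> {a..b} \<Longrightarrow> \<bar>f t\<bar> \<le> A"
    unfolding bounded_iff by (metis imageI real_norm_def)
  have "K \<in> borel_measurable (lebesgue_on {0..})"
    using K by (simp add: Linf_loc_on_def)
  then have K_meas: "K \<in> borel_measurable (lebesgue_on {a..b})"
    by (rule measurable_restrict_mono) (use a in auto)
  have f_meas: "f \<in> borel_measurable (lebesgue_on {a..b})"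
    using f by (intro continuous_imp_measurable_on_sets_lebesgue) auto
  have "integrable (lebesgue_on {a..b}) (\<lambda>t. sqrt (K t + f t))"
  proof (rule finite_measure.integrable_const_bound)
    show "finite_measure (lebesgue_on {a..b})"
      by (rule finite_measure_lebesgue_on) simp
    show "AE t in lebesgue_on {a..b}. norm (sqrt (K t + f t)) \<le> sqrt (B + A)"
    proof (subst AE_restrict_space_iff)
      show "AE t in lebesgue. t \<in> {a..b} \<longrightarrow> norm (sqrt (K t + f t)) \<le> sqrt (B + A)"
        using B
      proof eventually_elim
        fix t assume t: "t \<in> {a..b} \<longrightarrow> \<bar>K t\<bar> \<le> B"
        show "t \<in> {a..b} \<longrightarrow> norm (sqrt (K t + f t)) \<le> sqrt (B + A)"
        proof
          assume "t \<in> {a..b}"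
          then have "\<bar>K t + f t\<bar> \<le> B + A" using t A[of t] by linarith
          \<comment> \<open>The real \<open>sqrt\<close> is odd, so
            \<open>\<bar>sqrt x\<bar> = sqrt \<bar>x\<bar>\<close> also for negative
            \<open>x\<close>.\<close>
          then show "norm (sqrt (K t + f t)) \<le> sqrt (B + A)"
            by (simp add: real_sqrt_abs2[symmetric] real_sqrt_abs' del: real_sqrt_abs2)
        qed
      qed
    qed auto
    show "(\<lambda>t. sqrt (K t + f t)) \<in> borel_measurable (lebesgue_on {a..b})"
      using K_meas f_meas by measurable
  qed
  then show ?thesis by (simp add: integrable_restrict_space set_integrable_def)
qed

lemma is_solution_uminus:
  assumes "is_solution K g"
  shows "is_solution K (\<lambda>t. - g t)"
proof -
  obtain g' where 1: "\<And>t. t \<ge> 0 \<Longrightarrow> (g has_real_derivative g' t) (at t within {0..})"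
    and 2: "locally_lipschitz_on {0..} g'"
    and 3: "AE t in lebesgue. t \<ge> 0 \<longrightarrow>
      (\<exists>g''. (g' has_real_derivative g'') (at t within {0..}) \<and> g'' + K t * g t = 0)"
    using assms unfolding is_solution_def by blast
  show ?thesis unfolding is_solution_def
  proof (intro exI[of _ "\<lambda>t. - g' t"] conjI allI impI)
    show "((\<lambda>t. - g t) has_real_derivative - g' t) (at t within {0..})" if "t \<ge> 0" for t
      using 1[OF that] by (rule DERIV_minus)
    show "locally_lipschitz_on {0..} (\<lambda>t. - g' t)"
      using 2 unfolding locally_lipschitz_on_def by simp
    show "AE t in lebesgue. t \<ge> 0 \<longrightarrow>
      (\<exists>g''. ((\<lambda>t. - g' t) has_real_derivative g'') (at t within {0..}) \<and> g'' + K t * - g t = 0)"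
      using 3
    proof eventually_elim
      fix t assume "t \<ge> 0 \<longrightarrow>
        (\<exists>g''. (g' has_real_derivative g'') (at t within {0..}) \<and> g'' + K t * g t = 0)"
      then show "t \<ge> 0 \<longrightarrow>
        (\<exists>g''. ((\<lambda>t. - g' t) has_real_derivative g'') (at t within {0..}) \<and> g'' + K t * - g t = 0)"
        by (metis DERIV_minus minus_add_distrib minus_equation_iff mult_minus_right neg_0_equal_iff_equal)
    qed
  qed
qed

text \<open>The compactness theorem for \<open>local_lipschitz\<close> is applied to a family whose
  parameter ranges over the single point 0.\<close>

lemma locally_lipschitz_on_imp_lipschitz_on:
  assumes f: "locally_lipschitz_on S f" and "compact X" "X \<subseteq> S"
  shows "\<exists>L. L-lipschitz_on X f"
proof -
  have "local_lipschitz {0 :: real} X (\<lambda>_. f)"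
    unfolding local_lipschitz_def
  proof (intro ballI)
    fix x t assume x: "x \<in> X" "t \<in> {0 :: real}"
    then obtain u L where "u > 0" "L-lipschitz_on (cball x u \<inter> S) f"
      using f assms(3) unfolding locally_lipschitz_on_def by blast
    then show "\<exists>u>0. \<exists>L. \<forall>t\<in>cball t u \<inter> {0 :: real}. L-lipschitz_on (cball x u \<inter> X) f"
      using assms(3) lipschitz_on_subset by (metis Int_mono order_refl)
  qed
  then obtain L where "\<And>t. t \<in> {0 :: real} \<Longrightarrow> L-lipschitz_on X f"
    using local_lipschitz_compact_implies_lipschitz[of "{0 :: real}" X "\<lambda>_. f"] assms(2) by auto
  then show ?thesis by blast
qed

text \<open>Beyond its finitely many zeros \<open>g\<close> has constant sign by connectedness;
  linearity of the equation allows passing to \<open>- g\<close>.\<close>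

lemma nonoscillating_sign:
  assumes g: "is_solution K g" and "\<not> oscillates g"
  obtains T \<gamma> where "T \<ge> T0" "is_solution K \<gamma>" "\<And>t. t \<ge> T \<Longrightarrow> \<gamma> t > 0"
proof -
  have "finite {t. t \<ge> 0 \<and> g t = 0}" using assms(2) by (simp add: oscillates_def)
  then have "bdd_above {t. t \<ge> 0 \<and> g t = 0}" by (rule bdd_above_finite)
  then obtain b where b: "\<And>t. t \<ge> 0 \<Longrightarrow> g t = 0 \<Longrightarrow> t \<le> b"
    unfolding bdd_above_def by blast
  define T where "T = max T0 (max 0 (b + 1))"
  have T: "T \<ge> T0" "T \<ge> 0" "T > b" by (auto simp: T_def)
  have nz: "g t \<noteq> 0" if "t \<ge> T" for t using b[of t] T that by force
  have cont: "continuous_on {0..} g"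
    using g unfolding is_solution_def by (metis DERIV_continuous_on atLeast_iff)
  have "(\<forall>t\<ge>T. g t > 0) \<or> (\<forall>t\<ge>T. g t < 0)"
  proof (rule ccontr)
    assume "\<not> ?thesis"
    then obtain x y where xy: "x \<ge> T" "y \<ge> T" "g x < 0" "g y > 0"
      using nz by (metis linorder_neqE_linordered_idom)
    have "connected (g ` {T..})"
      using continuous_on_subset[OF cont, of "{T..}"] T by (intro connected_continuous_image) auto
    then have "0 \<in> g ` {T..}"
      using connectedD_interval[of "g ` {T..}" "g x" "g y" 0] xy by auto
    then show False using nz by auto
  qed
  then show thesis
    using that[of T g] that[of T "\<lambda>t. - g t"] g is_solution_uminus[OF g] T by auto
qed

lemma positive_solution_exists:
  assumes K: "Linf_loc_on {0..} K" and g: "is_solution K g" and nonosc: "\<not> oscillates g"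
    and f: "continuous_on {T0..} f" and T0: "T0 > 0"
    and lower: "AE t in lebesgue. t > T0 \<longrightarrow> K t + f t \<ge> 0"
  obtains T \<gamma> \<gamma>' N where "T > T0" "positive_solution K f \<gamma> \<gamma>' N T"
proof -
  \<comment> \<open>The margin 1 makes every \<open>t >= T\<close> satisfy the strict condition
    \<open>t > T0\<close> in \<open>lower\<close>. As \<open>T > 0\<close>, the one-sided
    derivatives on \<open>{0..}\<close> are two-sided there.\<close>
  obtain T \<gamma> where T: "T \<ge> T0 + 1" "\<And>t. t \<ge> T \<Longrightarrow> \<gamma> t > 0" and sol: "is_solution K \<gamma>"
    using nonoscillating_sign[OF g nonosc] by metis
  obtain \<gamma>' where 1: "\<And>t. t \<ge> 0 \<Longrightarrow> (\<gamma> has_real_derivative \<gamma>' t) (at t within {0..})"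
    and 2: "locally_lipschitz_on {0..} \<gamma>'"
    and 3: "AE t in lebesgue. t \<ge> 0 \<longrightarrow>
      (\<exists>g''. (\<gamma>' has_real_derivative g'') (at t within {0..}) \<and> g'' + K t * \<gamma> t = 0)"
    using sol unfolding is_solution_def by blast
  let ?P = "\<lambda>t. (t \<ge> 0 \<longrightarrow>
      (\<exists>g''. (\<gamma>' has_real_derivative g'') (at t within {0..}) \<and> g'' + K t * \<gamma> t = 0)) \<and>
      (t > T0 \<longrightarrow> K t + f t \<ge> 0)"
  have "AE t in lebesgue. ?P t" using 3 lower by eventually_elim blast
  then obtain N where N: "negligible N" "\<And>t. t \<notin> N \<Longrightarrow> ?P t"
    by (rule AE_E3) (simp add: negligible_iff_null_sets)
  have at: "at t within {0..} = at t" if "t \<ge> T" for t :: real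
    using that T T0 by (intro at_within_interior) simp
  have "positive_solution K f \<gamma> \<gamma>' N T"
  proof
    fix t assume t: "t \<ge> T"
    show "\<gamma> t > 0" using T t by simp
    show "(\<gamma> has_real_derivative \<gamma>' t) (at t)" using 1[of t] at[OF t] t T T0 by simp
    assume tN: "t \<notin> N"
    show "(\<gamma>' has_real_derivative - (K t * \<gamma> t)) (at t)"
      using N(2)[OF tN] at[OF t] t T T0 by (auto simp: add_eq_0_iff2)
    show "K t + f t \<ge> 0" using N(2)[OF tN] t T T0 by auto
  next
    fix a b :: real assume a: "T \<le> a"
    show "\<exists>L. L-lipschitz_on {a..b} \<gamma>'"
      using 2 by (rule locally_lipschitz_on_imp_lipschitz_on) (use a T T0 in auto)
    show "(\<lambda>t. sqrt (K t + f t)) integrable_on {a..b}"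
      using a T T0 by (intro set_lebesgue_integral_eq_integral(1) sqrt_potential_integrable[OF K]
        continuous_on_subset[OF f]) auto
  qed (use N in simp)
  then show thesis using T that[of T] by simp
qed

text \<open>Without oscillation, \<open>integral_sqrt_bound\<close> bounds the integral from some
  \<open>a\<close> on by \<open>C + R t <= C + target t\<close>. The part from \<open>t0\<close> to
  \<open>a\<close> is a constant, so the upper limit would be finite.\<close>

lemma oscillates_criterion:
  fixes R S r s r' s' target :: "real \<Rightarrow> real"
  assumes K: "Linf_loc_on {0..} K" and g: "is_solution K g"
    and t0: "t0 > 0" and f: "continuous_on {t0..} f"
    and lower: "AE t in lebesgue. t > t0 \<longrightarrow> K t + f t \<ge> 0"
    and R: "\<And>t. t \<ge> A \<Longrightarrow> (R has_real_derivative r t) (at t)"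
    and S: "\<And>t. t \<ge> A \<Longrightarrow> (S has_real_derivative s t) (at t)"
    and r: "\<And>t. t \<ge> A \<Longrightarrow> (r has_real_derivative r' t) (at t)"
    and s: "\<And>t. t \<ge> A \<Longrightarrow> (s has_real_derivative s' t) (at t)"
    and cont: "continuous_on {A..} r'" "continuous_on {A..} s'"
    and riccati: "\<And>t. t \<ge> A \<Longrightarrow> f t \<le> s' t + r' t + (s t + r t)\<^sup>2"
      "\<And>t. t \<ge> A \<Longrightarrow> f t \<le> s' t - r' t + (s t - r t)\<^sup>2"
    and m: "m > 0" "\<And>t. t \<ge> A \<Longrightarrow> m \<le> exp (2 * S t) * r t"
    and M: "\<And>t. t \<ge> A \<Longrightarrow> exp (2 * S t) * r t \<le> M"
    and R_lim: "filterlim R at_top at_top"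
    and R_le: "\<And>t. t \<ge> A \<Longrightarrow> R t \<le> target t"
    and limsup: "Limsup at_top (\<lambda>t::real. ereal
      ((LINT \<sigma>:{t0..t}|lebesgue. sqrt (K \<sigma> + f \<sigma>)) - target t)) = \<infinity>"
  shows "oscillates g"
proof (rule ccontr)
  assume nonosc: "\<not> oscillates g"
  define T1 where "T1 = max t0 A"
  have T1: "T1 \<ge> t0" "T1 \<ge> A" by (auto simp: T1_def)
  have f1: "continuous_on {T1..} f" using f by (rule continuous_on_subset) (use T1 in auto)
  have lower1: "AE t in lebesgue. t > T1 \<longrightarrow> K t + f t \<ge> 0"
    using lower by eventually_elim (use T1 in auto)
  obtain T \<gamma> \<gamma>' N where T: "T > T1" and pos: "positive_solution K f \<gamma> \<gamma>' N T"
    by (rule positive_solution_exists[OF K g nonosc f1 _ lower1]) (use T1 t0 in auto)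
  interpret positive_solution K f \<gamma> \<gamma>' N T by (rule pos)
  have TA: "t \<ge> A" if "t \<ge> T" for t using that T T1 by simp
  have sub: "{T..} \<subseteq> {A..}" using TA by auto
  obtain C a where a: "a \<ge> T"
    and C: "\<And>t. t \<ge> a \<Longrightarrow> integral {a..t} (\<lambda>t. sqrt (K t + f t)) \<le> C + R t"
    using integral_sqrt_bound[of R r S s r' s', OF R[OF TA] S[OF TA] r[OF TA] s[OF TA]
        cont(1)[THEN continuous_on_subset, OF sub] cont(2)[THEN continuous_on_subset, OF sub]
        riccati(1)[OF TA] riccati(2)[OF TA] m(1) m(2)[OF TA] M[OF TA] R_lim] by blast
  let ?q = "\<lambda>t. sqrt (K t + f t)"
  have at0: "a \<ge> t0" "a \<ge> A" using a T T1 by auto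
  have int: "set_integrable lebesgue {t0..t} ?q" for t
    using t0 by (intro sqrt_potential_integrable[OF K] continuous_on_subset[OF f]) auto
  have "(LINT \<sigma>:{t0..t}|lebesgue. ?q \<sigma>) - target t \<le> integral {t0..a} ?q + C" if t: "t \<ge> a" for t
  proof -
    have "(LINT \<sigma>:{t0..t}|lebesgue. ?q \<sigma>) = integral {t0..t} ?q"
      by (rule set_lebesgue_integral_eq_integral(2)[OF int])
    also have "\<dots> = integral {t0..a} ?q + integral {a..t} ?q"
      by (rule Henstock_Kurzweil_Integration.integral_combine[symmetric])
        (use at0 t set_lebesgue_integral_eq_integral(1)[OF int] in auto)
    also have "\<dots> \<le> integral {t0..a} ?q + (C + target t)"
      using C[OF t] R_le[of t] at0 t by simp
    finally show ?thesis by simp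
  qed
  then have "eventually (\<lambda>t. ereal ((LINT \<sigma>:{t0..t}|lebesgue. ?q \<sigma>) - target t)
      \<le> ereal (integral {t0..a} ?q + C)) at_top"
    by (intro eventually_mono[OF eventually_ge_at_top[of a]]) simp
  then have "Limsup at_top (\<lambda>t. ereal ((LINT \<sigma>:{t0..t}|lebesgue. ?q \<sigma>) - target t))
      \<le> ereal (integral {t0..a} ?q + C)"
    by (rule Limsup_bounded)
  then show False using limsup by simp
qed


section \<open>Comparison functions for the individual cases\<close>

text \<open>The comparison functions are the powers of \<open>t\<close> with exponents
  \<open>(1 + \<kappa>) / 2\<close> and \<open>(1 - \<kappa>) / 2\<close>, exact solutions of the
  Euler equation \<open>h'' = c / t^2 * h\<close>. Hence both Riccati inequalities are equalities
  and \<open>exp (2 * S) * r\<close> is the constant \<open>\<kappa> / 2\<close>. Either sign of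
  \<open>c\<close> is covered.\<close>

lemma oscillates_inverse_square:
  assumes K: "Linf_loc_on {0..} K" and g: "is_solution K g" and t0: "t0 > 0"
    and \<kappa>: "\<kappa> > 0" and c: "\<kappa>\<^sup>2 = 1 + 4 * c"
    and lower: "AE t in lebesgue. t > t0 \<longrightarrow> K t + c / t\<^sup>2 \<ge> 0"
    and limsup: "Limsup at_top (\<lambda>t::real. ereal
      ((LINT \<sigma>:{t0..t}|lebesgue. sqrt (K \<sigma> + c / \<sigma>\<^sup>2)) - \<kappa> / 2 * ln t)) = \<infinity>"
  shows "oscillates g"
proof (rule oscillates_criterion[where A = 1 and R = "\<lambda>t. \<kappa> / 2 * ln t" and r = "\<lambda>t. \<kappa> / (2 * t)"
    and r' = "\<lambda>t. - \<kappa> / (2 * t\<^sup>2)" and S = "\<lambda>t. ln t / 2" and s = "\<lambda>t. 1 / (2 * t)"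
    and s' = "\<lambda>t. - 1 / (2 * t\<^sup>2)" and m = "\<kappa> / 2" and M = "\<kappa> / 2", OF K g t0 _ lower _ _ _ _ _ _ _ _ _ _ _ _ _ limsup])
  show "continuous_on {t0..} (\<lambda>t. c / t\<^sup>2)"
    using t0 by (auto intro!: continuous_intros)
  show "continuous_on {1..} (\<lambda>t. - \<kappa> / (2 * t\<^sup>2))" "continuous_on {1..} (\<lambda>t. - 1 / (2 * t\<^sup>2) :: real)"
    by (auto intro!: continuous_intros)
  fix t :: real assume t: "t \<ge> 1"
  show "((\<lambda>t. \<kappa> / 2 * ln t) has_real_derivative \<kappa> / (2 * t)) (at t)"
    "((\<lambda>t. ln t / 2) has_real_derivative 1 / (2 * t)) (at t)"
    "((\<lambda>t. \<kappa> / (2 * t)) has_real_derivative - \<kappa> / (2 * t\<^sup>2)) (at t)"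
    "((\<lambda>t. 1 / (2 * t)) has_real_derivative - 1 / (2 * t\<^sup>2)) (at t)"
    using t by (auto intro!: derivative_eq_intros simp: power2_eq_square)
  have c': "c = (\<kappa>\<^sup>2 - 1) / 4" using c by simp
  show "c / t\<^sup>2 \<le> - 1 / (2 * t\<^sup>2) + - \<kappa> / (2 * t\<^sup>2) + (1 / (2 * t) + \<kappa> / (2 * t))\<^sup>2"
    "c / t\<^sup>2 \<le> - 1 / (2 * t\<^sup>2) - - \<kappa> / (2 * t\<^sup>2) + (1 / (2 * t) - \<kappa> / (2 * t))\<^sup>2"
    unfolding c' using t by (simp_all add: field_simps power2_eq_square)
  show "\<kappa> / 2 \<le> exp (2 * (ln t / 2)) * (\<kappa> / (2 * t))" "exp (2 * (ln t / 2)) * (\<kappa> / (2 * t)) \<le> \<kappa> / 2"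
    using t by simp_all
next
  show "filterlim (\<lambda>t. \<kappa> / 2 * ln t) at_top at_top"
    by (rule filterlim_tendsto_pos_mult_at_top[OF tendsto_const _ ln_at_top]) (use \<kappa> in simp)
qed (use \<kappa> in auto)

text \<open>At the double root of the Euler equation the two solutions are
  \<open>sqrt t * ln t\<close> and \<open>sqrt t\<close>; these are \<open>exp (S + R)\<close> and
  \<open>exp (S - R)\<close>. Starting at \<open>A = 2\<close> keeps \<open>ln t\<close>
  positive.\<close>

lemma oscillates_critical:
  assumes K: "Linf_loc_on {0..} K" and g: "is_solution K g" and t0: "t0 > 0"
    and lower: "AE t in lebesgue. t > t0 \<longrightarrow> K t - 1 / (4 * t\<^sup>2) \<ge> 0"
    and limsup: "Limsup at_top (\<lambda>t::real. ereal
      ((LINT \<sigma>:{t0..t}|lebesgue. sqrt (K \<sigma> - 1 / (4 * \<sigma>\<^sup>2))) - 1 / 2 * ln (ln t))) = \<infinity>"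
  shows "oscillates g"
proof (rule oscillates_criterion[where A = 2 and R = "\<lambda>t. 1 / 2 * ln (ln t)" and f = "\<lambda>t. - (1 / (4 * t\<^sup>2))"
    and r = "\<lambda>t. 1 / (2 * t * ln t)" and r' = "\<lambda>t. - (ln t + 1) / (2 * (t * ln t)\<^sup>2)"
    and S = "\<lambda>t. (ln t + ln (ln t)) / 2" and s = "\<lambda>t. 1 / (2 * t) + 1 / (2 * t * ln t)"
    and s' = "\<lambda>t. - 1 / (2 * t\<^sup>2) + - (ln t + 1) / (2 * (t * ln t)\<^sup>2)" and m = "1 / 2" and M = "1 / 2",
    OF K g t0])
  show "AE t in lebesgue. t > t0 \<longrightarrow> K t + - (1 / (4 * t\<^sup>2)) \<ge> 0"
    using lower by simp
  show "Limsup at_top (\<lambda>t::real. ereal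
      ((LINT \<sigma>:{t0..t}|lebesgue. sqrt (K \<sigma> + - (1 / (4 * \<sigma>\<^sup>2)))) - 1 / 2 * ln (ln t))) = \<infinity>"
    using limsup by simp
  show "continuous_on {t0..} (\<lambda>t. - (1 / (4 * t\<^sup>2)))"
    using t0 by (auto intro!: continuous_intros)
  have ln_pos: "ln t > 0" if "t \<ge> 2" for t :: real using that by simp
  show "continuous_on {2..} (\<lambda>t::real. - (ln t + 1) / (2 * (t * ln t)\<^sup>2))"
    "continuous_on {2..} (\<lambda>t::real. - 1 / (2 * t\<^sup>2) + - (ln t + 1) / (2 * (t * ln t)\<^sup>2))"
    by (auto intro!: continuous_intros)
  fix t :: real assume t: "t \<ge> 2"
  define L where "L = ln t"
  have L: "L > 0" using ln_pos[OF t] by (simp add: L_def)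
  show R: "((\<lambda>t. 1 / 2 * ln (ln t)) has_real_derivative 1 / (2 * t * ln t)) (at t)"
    and "((\<lambda>t. (ln t + ln (ln t)) / 2) has_real_derivative 1 / (2 * t) + 1 / (2 * t * ln t)) (at t)"
    using t ln_pos[OF t] by (auto intro!: derivative_eq_intros simp: field_simps)
  show r: "((\<lambda>t. 1 / (2 * t * ln t)) has_real_derivative - (ln t + 1) / (2 * (t * ln t)\<^sup>2)) (at t)"
    using t ln_pos[OF t] by (auto intro!: derivative_eq_intros simp: field_simps power2_eq_square)
  have "((\<lambda>t. 1 / (2 * t)) has_real_derivative - 1 / (2 * t\<^sup>2)) (at t)"
    using t by (auto intro!: derivative_eq_intros simp: power2_eq_square)
  then show "((\<lambda>t. 1 / (2 * t) + 1 / (2 * t * ln t)) has_real_derivative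
      - 1 / (2 * t\<^sup>2) + - (ln t + 1) / (2 * (t * ln t)\<^sup>2)) (at t)"
    using r by (rule DERIV_add)
  show "- (1 / (4 * t\<^sup>2)) \<le> - 1 / (2 * t\<^sup>2) + - (ln t + 1) / (2 * (t * ln t)\<^sup>2)
      + - (ln t + 1) / (2 * (t * ln t)\<^sup>2) + (1 / (2 * t) + 1 / (2 * t * ln t) + 1 / (2 * t * ln t))\<^sup>2"
    "- (1 / (4 * t\<^sup>2)) \<le> - 1 / (2 * t\<^sup>2) + - (ln t + 1) / (2 * (t * ln t)\<^sup>2)
      - - (ln t + 1) / (2 * (t * ln t)\<^sup>2) + (1 / (2 * t) + 1 / (2 * t * ln t) - 1 / (2 * t * ln t))\<^sup>2"
    unfolding L_def[symmetric] using t L by (simp_all add: field_simps power2_eq_square)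
  have "exp (2 * ((ln t + ln (ln t)) / 2)) = t * ln t"
    using t ln_pos[OF t] exp_add[of "ln t" "ln (ln t)"] by (simp add: add_divide_distrib)
  then show "1 / 2 \<le> exp (2 * ((ln t + ln (ln t)) / 2)) * (1 / (2 * t * ln t))"
    "exp (2 * ((ln t + ln (ln t)) / 2)) * (1 / (2 * t * ln t)) \<le> 1 / 2"
    using t ln_pos[OF t] by simp_all
next
  show "filterlim (\<lambda>t::real. 1 / 2 * ln (ln t)) at_top at_top"
    by (rule filterlim_tendsto_pos_mult_at_top[OF tendsto_const _ filterlim_compose[OF ln_at_top ln_at_top]]) simp
qed auto


text \<open>The comparison exponents \<open>\<plusminus> r - \<alpha> / (4 t)\<close> are the WKB approximation \<open>\<plusminus> B t\<^sup>\<alpha>\<^sup>/\<^sup>2 - \<alpha> / (4 t)\<close>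
  with an integrable correction in \<open>r\<close> which makes both of them Riccati supersolutions for large \<open>t\<close>.\<close>

lemma oscillates_power:
  fixes \<alpha> :: real
  assumes K: "Linf_loc_on {0..} K" and g: "is_solution K g" and t0: "t0 > 0"
    and B: "B > 0" and \<alpha>: "\<alpha> > -2"
    and lower: "AE t in lebesgue. t > t0 \<longrightarrow> K t + B\<^sup>2 * t powr \<alpha> \<ge> 0"
    and limsup: "Limsup at_top (\<lambda>t::real. ereal
      ((LINT \<sigma>:{t0..t}|lebesgue. sqrt (K \<sigma> + B\<^sup>2 * \<sigma> powr \<alpha>))
        - 2 * B / (\<alpha> + 2) * t powr (\<alpha> / 2 + 1))) = \<infinity>"
  shows "oscillates g"
proof -
  define \<beta> where "\<beta> = \<alpha> / 2 + 1"
  have \<beta>: "\<beta> > 0" "\<alpha> = 2 * \<beta> - 2" using \<alpha> by (auto simp: \<beta>_def)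
  \<comment> \<open>The cross term \<open>2 * B * c\<close> in the square of \<open>r\<close> then
    contributes 1/2: one quarter completes the square \<open>(\<alpha> + 2)^2 / 16\<close>, the
    other remains as slack.\<close>
  define c where "c = 1 / (4 * B)"
  have c: "c > 0" "B * c = 1 / 4" using B by (auto simp: c_def)
  \<comment> \<open>The correction in \<open>r\<close> integrates to a negative term, so
    \<open>R\<close> stays below the subtracted term
    \<open>B / \<beta> * t powr \<beta>\<close>.\<close>
  define R where "R t = B / \<beta> * t powr \<beta> - c / \<beta> * t powr (- \<beta>)" for t
  define r where "r t = B * t powr (\<beta> - 1) + c * t powr (- \<beta> - 1)" for t
  define r' where "r' t = B * (\<beta> - 1) * t powr (\<beta> - 2) + c * (- \<beta> - 1) * t powr (- \<beta> - 2)" for t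
  have "((\<lambda>t::real. t powr (- \<beta>)) \<longlongrightarrow> 0) at_top"
    by (rule tendsto_neg_powr) (use \<beta> filterlim_ident in auto)
  \<comment> \<open>The threshold makes \<open>2 * c * \<beta> * t powr (- \<beta>)\<close> at most
    the slack 1/4.\<close>
  then have "eventually (\<lambda>t::real. t powr (- \<beta>) < 1 / (8 * c * \<beta>)) at_top"
    by (rule order_tendstoD) (use c \<beta> in auto)
  then obtain T1 where T1: "\<And>t. t \<ge> T1 \<Longrightarrow> t powr (- \<beta>) < 1 / (8 * c * \<beta>)"
    by (auto simp: eventually_at_top_linorder)
  \<comment> \<open>\<open>T0 >= 1\<close> gives \<open>t powr (- \<beta>) <= 1\<close>, used for
    the growth of \<open>R\<close> and for the upper bound \<open>B + c\<close>.\<close>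
  define T0 where "T0 = max 1 T1"
  have T0: "t > 0" "t \<ge> 1" "t powr (- \<beta>) < 1 / (8 * c * \<beta>)" if "t \<ge> T0" for t
    using that T1[of t] by (auto simp: T0_def)
  have small: "t powr (- \<beta>) \<le> 1" if "t \<ge> T0" for t
    using T0[OF that] \<beta> powr_mono[of "- \<beta>" 0 t] by simp
  have R_lim: "filterlim R at_top at_top"
  proof (rule filterlim_at_top_mono)
    have "filterlim (\<lambda>t::real. B / \<beta> * t powr \<beta>) at_top at_top"
      by (rule filterlim_tendsto_pos_mult_at_top[OF tendsto_const _ real_powr_at_top]) (use B \<beta> in auto)
    then show "filterlim (\<lambda>t. - (c / \<beta>) + B / \<beta> * t powr \<beta>) at_top at_top"
      by (rule filterlim_tendsto_add_at_top[OF tendsto_const])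
    show "eventually (\<lambda>t. - (c / \<beta>) + B / \<beta> * t powr \<beta> \<le> R t) at_top"
    proof (rule eventually_mono[OF eventually_ge_at_top[of T0]])
      fix t assume "T0 \<le> t"
      then show "- (c / \<beta>) + B / \<beta> * t powr \<beta> \<le> R t"
        using mult_left_mono[OF small, of t "c / \<beta>"] c \<beta> by (simp add: R_def)
    qed
  qed
  have normal: "t powr (\<beta> - 1) = t powr \<beta> / t" "t powr (- \<beta> - 1) = t powr (- \<beta>) / t"
    "t powr (\<beta> - 2) = t powr \<beta> / t\<^sup>2" "t powr (- \<beta> - 2) = t powr (- \<beta>) / t\<^sup>2"
    "t powr \<alpha> = (t powr \<beta> / t)\<^sup>2" "t powr \<beta> * t powr (- \<beta>) = 1" if "t > 0" for t
  proof -
    have "t powr 1 = t" "t powr 2 = t\<^sup>2" using that by (simp_all add: powr_numeral)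
    then show "t powr (\<beta> - 1) = t powr \<beta> / t" "t powr (- \<beta> - 1) = t powr (- \<beta>) / t"
      "t powr (\<beta> - 2) = t powr \<beta> / t\<^sup>2" "t powr (- \<beta> - 2) = t powr (- \<beta>) / t\<^sup>2"
      by (simp_all only: powr_diff)
    show "t powr \<alpha> = (t powr \<beta> / t)\<^sup>2"
      unfolding \<beta>(2) powr_diff using that
      by (simp add: power_divide powr_numeral power2_eq_square powr_add[symmetric])
    show "t powr \<beta> * t powr (- \<beta>) = 1"
      using that by (simp add: powr_add[symmetric])
  qed
  \<comment> \<open>Multiplied by \<open>t^2\<close>, the inequality is polynomial in
    \<open>X\<close> and \<open>Y\<close> with \<open>X * Y = 1\<close>; \<open>\<epsilon>\<close>
    treats both comparison functions at once.\<close>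
  have riccati: "B\<^sup>2 * t powr \<alpha> \<le> \<alpha> / (4 * t\<^sup>2) + \<epsilon> * r' t + (- \<alpha> / (4 * t) + \<epsilon> * r t)\<^sup>2"
    if t: "t \<ge> T0" and \<epsilon>: "\<epsilon> = 1 \<or> \<epsilon> = -1" for t \<epsilon>
  proof -
    define X Y where "X = t powr \<beta>" and "Y = t powr (- \<beta>)"
    have t0: "t > 0" using T0[OF t] by simp
    have Y: "Y > 0" "2 * c * \<beta> * Y \<le> 1 / 4"
      using T0[OF t] c \<beta> t0 by (auto simp: Y_def field_simps)
    have XY: "X * Y = 1" unfolding X_def Y_def by (rule normal(6)[OF t0])
    have \<epsilon>2: "\<epsilon>\<^sup>2 = 1" using \<epsilon> by auto
    have "\<alpha> / 4 + \<epsilon> * (B * (\<beta> - 1) * X + c * (- \<beta> - 1) * Y) + (- \<alpha> / 4 + \<epsilon> * (B * X + c * Y))\<^sup>2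
        - B\<^sup>2 * X\<^sup>2
      = \<alpha> / 4 + \<alpha>\<^sup>2 / 16 + 2 * (B * c) * (X * Y) + c\<^sup>2 * Y\<^sup>2 - \<epsilon> * (2 * c * \<beta> * Y)"
      using \<epsilon>2 unfolding \<beta>(2) by algebra
    also have "\<dots> = (\<alpha> + 2)\<^sup>2 / 16 + 1 / 4 + c\<^sup>2 * Y\<^sup>2 - \<epsilon> * (2 * c * \<beta> * Y)"
      unfolding c(2) XY by (simp add: power2_eq_square field_simps)
    also have "\<dots> \<ge> 0"
    proof -
      have bound: "\<epsilon> * w \<le> 1 / 4" if "0 < w" "w \<le> 1 / 4" for w
        using \<epsilon> that by auto
      have "\<epsilon> * (2 * c * \<beta> * Y) \<le> 1 / 4"
        by (rule bound[OF _ Y(2)]) (use c \<beta> Y(1) in simp)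
      moreover have "(\<alpha> + 2)\<^sup>2 / 16 \<ge> 0" "c\<^sup>2 * Y\<^sup>2 \<ge> 0" by simp_all
      ultimately show ?thesis by linarith
    qed
    finally have "B\<^sup>2 * X\<^sup>2 / t\<^sup>2 \<le> (\<alpha> / 4 + \<epsilon> * (B * (\<beta> - 1) * X + c * (- \<beta> - 1) * Y)
        + (- \<alpha> / 4 + \<epsilon> * (B * X + c * Y))\<^sup>2) / t\<^sup>2"
      by (intro divide_right_mono) auto
    also have "\<dots> = \<alpha> / (4 * t\<^sup>2) + \<epsilon> * r' t + (- \<alpha> / (4 * t) + \<epsilon> * r t)\<^sup>2"
      unfolding r_def r'_def normal[OF t0] X_def[symmetric] Y_def[symmetric]
      using t0 by (simp add: field_simps power2_eq_square)
    finally show ?thesis unfolding normal(5)[OF t0] X_def by (simp add: power_divide)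
  qed
  \<comment> \<open>The term \<open>- \<alpha> / 4 * ln t\<close> is the WKB amplitude:
    \<open>exp (2 * S)\<close> is \<open>t powr (1 - \<beta>)\<close>, which cancels the leading
    factor of \<open>r\<close>.\<close>
  have gap: "exp (2 * (- \<alpha> / 4 * ln t)) * r t = B + c * (t powr (- \<beta>))\<^sup>2" if t: "t \<ge> T0" for t
  proof -
    have t0: "t > 0" using T0[OF t] by simp
    have "exp (2 * (- \<alpha> / 4 * ln t)) = t powr (1 - \<beta>)"
      using t0 by (simp add: powr_def \<beta>(2) field_simps)
    also have "\<dots> = t * t powr (- \<beta>)" using t0 by (simp add: powr_diff powr_minus_divide)
    finally have "exp (2 * (- \<alpha> / 4 * ln t)) * r t
        = B * (t powr \<beta> * t powr (- \<beta>)) + c * (t powr (- \<beta>))\<^sup>2"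
      unfolding r_def normal(1,2)[OF t0] using t0 by (simp add: field_simps power2_eq_square)
    then show ?thesis unfolding normal(6)[OF t0] by simp
  qed
  have target: "2 * B / (\<alpha> + 2) * t powr (\<alpha> / 2 + 1) = B / \<beta> * t powr \<beta>" for t
    using \<beta>(1) by (simp add: \<beta>_def field_simps)
  show ?thesis
  proof (rule oscillates_criterion[where A = T0 and R = R and r = r and r' = r'
        and S = "\<lambda>t. - \<alpha> / 4 * ln t" and s = "\<lambda>t. - \<alpha> / (4 * t)"
        and s' = "\<lambda>t. \<alpha> / (4 * t\<^sup>2)" and m = B and M = "B + c",
        OF K g t0 _ lower _ _ _ _ _ _ _ _ _ _ _ R_lim _ limsup])
    show "continuous_on {t0..} (\<lambda>t. B\<^sup>2 * t powr \<alpha>)"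
      using t0 by (auto intro!: continuous_intros)
    show "continuous_on {T0..} r'" "continuous_on {T0..} (\<lambda>t. \<alpha> / (4 * t\<^sup>2))"
      \<comment> \<open>The instance at 0 shows that 0 lies outside \<open>{T0..}\<close>, so no
        denominator vanishes.\<close>
      unfolding r'_def[abs_def] using T0(1)[of 0] T0(1) by (auto intro!: continuous_intros)
    fix t assume t: "t \<ge> T0"
    have t0: "t > 0" using T0[OF t] by simp
    show "(R has_real_derivative r t) (at t)" "(r has_real_derivative r' t) (at t)"
      unfolding R_def[abs_def] r_def[abs_def] r'_def using t0 \<beta>
      by (auto intro!: derivative_eq_intros simp: field_simps)
    show "((\<lambda>t. - \<alpha> / 4 * ln t) has_real_derivative - \<alpha> / (4 * t)) (at t)"
      "((\<lambda>t. - \<alpha> / (4 * t)) has_real_derivative \<alpha> / (4 * t\<^sup>2)) (at t)"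
      using t0 by (auto intro!: derivative_eq_intros simp: power2_eq_square)
    show "B\<^sup>2 * t powr \<alpha> \<le> \<alpha> / (4 * t\<^sup>2) + r' t + (- \<alpha> / (4 * t) + r t)\<^sup>2"
      "B\<^sup>2 * t powr \<alpha> \<le> \<alpha> / (4 * t\<^sup>2) - r' t + (- \<alpha> / (4 * t) - r t)\<^sup>2"
      using riccati[OF t, of 1] riccati[OF t, of "-1"] by simp_all
    show "B \<le> exp (2 * (- \<alpha> / 4 * ln t)) * r t" "exp (2 * (- \<alpha> / 4 * ln t)) * r t \<le> B + c"
      unfolding gap[OF t] using c small[OF t] by (simp_all add: power_le_one)
    show "R t \<le> 2 * B / (\<alpha> + 2) * t powr (\<alpha> / 2 + 1)"
      unfolding target R_def using c \<beta> by simp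
  qed (use B in auto)
qed

text \<open>The Euler comparison serves \<alpha> = -2 with \<open>c = B^2\<close> and B < 1/2 with
  \<open>c = - B^2\<close>. At B = 1/2 its two exponents coincide, and for \<alpha> > -2 powers are
  replaced by WKB exponentials.\<close>

theorem theorem9:
  fixes K g :: "real \<Rightarrow> real"
  assumes K: "Linf_loc_on {0..} K"
    and g: "is_solution K g"
    and nontrivial: "\<exists>t\<ge>0. g t \<noteq> 0"
  shows
    "(\<forall>(B::real) (\<alpha>::real) (t\<^sub>0::real).
        B > 0 \<and> \<alpha> \<ge> -2 \<and> t\<^sub>0 > 0 \<and>
        (AE t in lebesgue. t > t\<^sub>0 \<longrightarrow> K t \<ge> - (B\<^sup>2 * t powr \<alpha>)) \<and>
        (\<alpha> = -2 \<longrightarrow>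
           Limsup at_top (\<lambda>t::real. ereal
             ((LINT s:{t\<^sub>0..t}|lebesgue. sqrt (K s + B\<^sup>2 / s\<^sup>2))
               - sqrt (1 + 4 * B\<^sup>2) / 2 * ln t)) = \<infinity>) \<and>
        (\<alpha> > -2 \<longrightarrow>
           Limsup at_top (\<lambda>t::real. ereal
             ((LINT s:{t\<^sub>0..t}|lebesgue. sqrt (K s + B\<^sup>2 * s powr \<alpha>))
               - 2 * B / (\<alpha> + 2) * t powr (\<alpha> / 2 + 1))) = \<infinity>)
        \<longrightarrow> oscillates g)
     \<and>
     (\<forall>(B::real) (t\<^sub>0::real).
        0 \<le> B \<and> B \<le> 1 / 2 \<and> t\<^sub>0 > 0 \<and>
        (AE t in lebesgue. t > t\<^sub>0 \<longrightarrow> K t \<ge> B\<^sup>2 / t\<^sup>2) \<and>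
        (B < 1 / 2 \<longrightarrow>
           Limsup at_top (\<lambda>t::real. ereal
             ((LINT s:{t\<^sub>0..t}|lebesgue. sqrt (K s - B\<^sup>2 / s\<^sup>2))
               - sqrt (1 - 4 * B\<^sup>2) / 2 * ln t)) = \<infinity>) \<and>
        (B = 1 / 2 \<longrightarrow>
           Limsup at_top (\<lambda>t::real. ereal
             ((LINT s:{t\<^sub>0..t}|lebesgue. sqrt (K s - 1 / (4 * s\<^sup>2)))
               - 1 / 2 * ln (ln t))) = \<infinity>)
        \<longrightarrow> oscillates g)"
proof (intro conjI allI impI; elim conjE)
  fix B \<alpha> t\<^sub>0 :: real
  assume B: "B > 0" and \<alpha>: "\<alpha> \<ge> -2" and t0: "t\<^sub>0 > 0"
    and lower: "AE t in lebesgue. t > t\<^sub>0 \<longrightarrow> K t \<ge> - (B\<^sup>2 * t powr \<alpha>)"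
    and eq: "\<alpha> = -2 \<longrightarrow>
      Limsup at_top (\<lambda>t::real. ereal
        ((LINT s:{t\<^sub>0..t}|lebesgue. sqrt (K s + B\<^sup>2 / s\<^sup>2)) - sqrt (1 + 4 * B\<^sup>2) / 2 * ln t)) = \<infinity>"
    and gt: "\<alpha> > -2 \<longrightarrow>
      Limsup at_top (\<lambda>t::real. ereal
        ((LINT s:{t\<^sub>0..t}|lebesgue. sqrt (K s + B\<^sup>2 * s powr \<alpha>))
          - 2 * B / (\<alpha> + 2) * t powr (\<alpha> / 2 + 1))) = \<infinity>"
  show "oscillates g"
  proof (cases "\<alpha> = -2")
    case True
    show ?thesis
    proof (rule oscillates_inverse_square[OF K g t0])
      have "1 + 4 * B\<^sup>2 > 0" by (simp add: add_pos_nonneg)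
      then show "sqrt (1 + 4 * B\<^sup>2) > 0" "(sqrt (1 + 4 * B\<^sup>2))\<^sup>2 = 1 + 4 * B\<^sup>2" by auto
      show "AE t in lebesgue. t > t\<^sub>0 \<longrightarrow> K t + B\<^sup>2 / t\<^sup>2 \<ge> 0"
        using lower
      proof eventually_elim
        fix t assume le: "t > t\<^sub>0 \<longrightarrow> K t \<ge> - (B\<^sup>2 * t powr \<alpha>)"
        show "t > t\<^sub>0 \<longrightarrow> K t + B\<^sup>2 / t\<^sup>2 \<ge> 0"
        proof
          assume "t > t\<^sub>0"
          moreover from this have "t powr \<alpha> = 1 / t\<^sup>2"
            using True t0 by (simp add: powr_minus_divide powr_numeral)
          ultimately show "K t + B\<^sup>2 / t\<^sup>2 \<ge> 0" using le by simp
        qed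
      qed
    qed (use eq True in blast)
  next
    case False
    have "AE t in lebesgue. t > t\<^sub>0 \<longrightarrow> K t + B\<^sup>2 * t powr \<alpha> \<ge> 0"
      using lower by eventually_elim force
    then show ?thesis
      using oscillates_power[OF K g t0 B] False \<alpha> gt by force
  qed
next
  fix B t\<^sub>0 :: real
  assume B: "0 \<le> B" "B \<le> 1 / 2" and t0: "t\<^sub>0 > 0"
    and lower: "AE t in lebesgue. t > t\<^sub>0 \<longrightarrow> K t \<ge> B\<^sup>2 / t\<^sup>2"
    and lt: "B < 1 / 2 \<longrightarrow>
      Limsup at_top (\<lambda>t::real. ereal
        ((LINT s:{t\<^sub>0..t}|lebesgue. sqrt (K s - B\<^sup>2 / s\<^sup>2)) - sqrt (1 - 4 * B\<^sup>2) / 2 * ln t)) = \<infinity>"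
    and eq: "B = 1 / 2 \<longrightarrow>
      Limsup at_top (\<lambda>t::real. ereal
        ((LINT s:{t\<^sub>0..t}|lebesgue. sqrt (K s - 1 / (4 * s\<^sup>2))) - 1 / 2 * ln (ln t))) = \<infinity>"
  show "oscillates g"
  proof (cases "B = 1 / 2")
    case True
    have "AE t in lebesgue. t > t\<^sub>0 \<longrightarrow> K t - 1 / (4 * t\<^sup>2) \<ge> 0"
      using lower by eventually_elim (simp add: True power2_eq_square)
    then show ?thesis
      using oscillates_critical[OF K g t0] True eq by blast
  next
    case False
    show ?thesis
    proof (rule oscillates_inverse_square[OF K g t0, where c = "- B\<^sup>2"])
      have "B\<^sup>2 < (1 / 2)\<^sup>2"
        using B False by (intro power_strict_mono) auto
      then have "1 - 4 * B\<^sup>2 > 0" by (simp add: power2_eq_square)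
      then show "sqrt (1 - 4 * B\<^sup>2) > 0" "(sqrt (1 - 4 * B\<^sup>2))\<^sup>2 = 1 + 4 * (- B\<^sup>2)" by auto
      show "AE t in lebesgue. t > t\<^sub>0 \<longrightarrow> K t + - B\<^sup>2 / t\<^sup>2 \<ge> 0"
        using lower by eventually_elim simp
    qed (use lt False B in simp)
  qed
qed

end
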